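(* Let $G$ be a mixed graph on $n$ vertices. Then $G$ is $(r,s)$-regular if and only if $2(r+s)$ and $2r$ are eigenvalues of the integrated signless Laplacian matrix $\mathcal{I}^Q(G)$ with corresponding eigenvectors $\mathbf{1}_{2n}$ and $\begin{bmatrix}\mathbf{1}_n^T & -\mathbf{1}_n^T\end{bmatrix}^T$, respectively (where the first $n$ coordinates correspond to $v'_1,\dots,v'_n$ and the last $n$ to $v''_1,\dots,v''_n$).
   Context: A mixed graph $G=(V_G,E_G,\vec{E}_G)$ has a finite vertex set, a multiset $E_G$ of unordered pairs (edges; $\{v,v\}$ is a loop) and a multiset $\vec{E}_G$ of ordered pairs (arcs; $(v,v)$ is a directed loop). $d(v)$ is the number of edges at $v$, loops counted twice; $d^+(v)$ (resp. $d^-(v)$) the number of arcs starting (resp. ending) at $v$, directed loops included. $G$ is $(r,s)$-regular if $d(u)=r$ and $d^+(u)=d^-(u)=s$ for all $u\in V_G$. $\mathbf{1}_m$ is the all-ones column vector of length $m$. For $V_G=\{v_1,\dots,v_n\}$, the integrated adjacency matrix $\mathcal{I}(G)$ is the $2n\times 2n$ matrix indexed by $v'_1,\dots,v'_n,v''_1,\dots,v''_n$ whose $(v'_i,v'_j)$ and $(v''_i,v''_j)$ entries are the number of edges joining $v_i,v_j$ if $i\neq j$ and $2\times$(number of loops at $v_i$) if $i=j$, and whose $(v'_i,v''_j)$ and $(v''_j,v'_i)$ entries are the number of arcs from $v_i$ to $v_j$. The integrated degree matrix $\mathcal{I}^D(G)$ is diagonal with $(v'_i,v'_i)$ entry $d(v_i)+d^+(v_i)$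 and $(v''_i,v''_i)$ entry $d(v_i)+d^-(v_i)$; $\mathcal{I}^Q(G)=\mathcal{I}^D(G)+\mathcal{I}(G)$. *)

theory Defs
  imports "HOL-Library.Uprod" "HOL-Library.Multiset" "Jordan_Normal_Form.Char_Poly"
begin

text \<open>Unordered pairs are elements of \<open>'a uprod\<close>; the loop at \<open>v\<close> is \<open>Upair v v\<close>.\<close>

record 'a mgraph =
  verts :: "'a set"
  edges :: "'a uprod multiset"
  arcs :: "('a \<times> 'a) multiset"

locale mixed_graph =
  fixes G :: "'a mgraph"
  assumes finite_verts: "finite (verts G)"
    and edges_verts: "e \<in># edges G \<Longrightarrow> set_uprod e \<subseteq> verts G"
    and arcs_verts: "a \<in># arcs G \<Longrightarrow> a \<in> verts G \<times> verts G"

text \<open>The second summand counts every loop at \<open>v\<close> a second time.\<close>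

definition degree :: "'a mgraph \<Rightarrow> 'a \<Rightarrow> nat" where
  "degree G v = size {# e \<in># edges G. v \<in> set_uprod e #} + count (edges G) (Upair v v)"

definition out_degree :: "'a mgraph \<Rightarrow> 'a \<Rightarrow> nat" where
  "out_degree G v = size {# a \<in># arcs G. fst a = v #}"

definition in_degree :: "'a mgraph \<Rightarrow> 'a \<Rightarrow> nat" where
  "in_degree G v = size {# a \<in># arcs G. snd a = v #}"

definition mixed_regular :: "nat \<Rightarrow> nat \<Rightarrow> 'a mgraph \<Rightarrow> bool" where
  "mixed_regular r s G \<longleftrightarrow>
     (\<forall>u \<in> verts G. degree G u = r \<and> out_degree G u = s \<and> in_degree G u = s)"

text \<open>
  In the matrices below \<open>v 0, \<dots>, v (n - 1)\<close> enumerates the vertices of \<open>G\<close>. Row and column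
  \<open>i < n\<close> of a \<open>2n \<times> 2n\<close> matrix belong to the first copy of the vertex \<open>v i\<close>, row and
  column \<open>n + i\<close> to its second copy.
\<close>

definition edge_matrix :: "nat \<Rightarrow> (nat \<Rightarrow> 'a) \<Rightarrow> 'a mgraph \<Rightarrow> real mat" where
  "edge_matrix n v G = mat n n (\<lambda>(i, j).
     if i = j then 2 * real (count (edges G) (Upair (v i) (v i)))
     else real (count (edges G) (Upair (v i) (v j))))"

definition arc_matrix :: "nat \<Rightarrow> (nat \<Rightarrow> 'a) \<Rightarrow> 'a mgraph \<Rightarrow> real mat" where
  "arc_matrix n v G = mat n n (\<lambda>(i, j). real (count (arcs G) (v i, v j)))"

definition integrated_adjacency :: "nat \<Rightarrow> (nat \<Rightarrow> 'a) \<Rightarrow> 'a mgraph \<Rightarrow> real mat" where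
  "integrated_adjacency n v G =
     four_block_mat (edge_matrix n v G) (arc_matrix n v G)
       (transpose_mat (arc_matrix n v G)) (edge_matrix n v G)"

definition integrated_degree :: "nat \<Rightarrow> (nat \<Rightarrow> 'a) \<Rightarrow> 'a mgraph \<Rightarrow> real mat" where
  "integrated_degree n v G = mat_diag (2 * n) (\<lambda>i.
     if i < n then real (degree G (v i) + out_degree G (v i))
     else real (degree G (v (i - n)) + in_degree G (v (i - n))))"

definition integrated_signless_laplacian :: "nat \<Rightarrow> (nat \<Rightarrow> 'a) \<Rightarrow> 'a mgraph \<Rightarrow> real mat" where
  "integrated_signless_laplacian n v G = integrated_degree n v G + integrated_adjacency n v G"

definition all_ones_vec :: "nat \<Rightarrow> real vec" where
  "all_ones_vec m = vec m (\<lambda>_. 1)"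

end

theory Submission
  imports Defs
begin

text \<open>In the integrated adjacency matrix, each row of an edge block sums to the degree of its
  vertex, and the rows and columns of the arc block sum to the out- and in-degrees. Hence the
  signless Laplacian sends the vector with value 1 on the first copies and c on the second copies to
  2d + (1 + c)d^+ on the first copies and 2cd + (1 + c)d^- on the second
  (\<open>integrated_signless_laplacian_mult_block_constant\<close>). The two vectors of the theorem
  are c = 1 and c = -1. For c = -1 the arcs cancel, and eigenvalue 2r says exactly d = r. Given
  this, eigenvalue 2(r + s) for c = 1 says exactly d^+ = d^- = s. The bridge from degrees, which are
  sizes of filtered multisets, to matrix entries, which are multiplicities, is
  \<open>size_filter_mset_eq_sum_count\<close>: the incident edges or arcs are indexed by their
  other endpoint.\<close>

lemma size_filter_mset_eq_sum_count:
  assumes "finite A" and "inj_on g A"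
    and "{e \<in> set_mset M. P e} \<subseteq> g ` A" and "\<And>a. a \<in> A \<Longrightarrow> P (g a)"
  shows "size (filter_mset P M) = (\<Sum>a\<in>A. count M (g a))"
proof -
  have "size (filter_mset P M) = (\<Sum>e | e \<in># M \<and> P e. count M e)"
    by (simp add: size_multiset_overloaded_eq)
  also have "\<dots> = (\<Sum>e\<in>g ` A. count M e)"
    \<comment> \<open>Every \<open>g a\<close> satisfies \<open>P\<close>, so a point of the image
      outside the index set is absent from \<open>M\<close> and has multiplicity 0.\<close>
    using assms by (intro sum.mono_neutral_left) (auto simp: not_in_iff)
  also have "\<dots> = (\<Sum>a\<in>A. count M (g a))"
    using assms(2) by (simp add: sum.reindex)
  finally show ?thesis .
qed

context mixed_graph
begin

lemma out_degree_eq_sum: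
  "x \<in> verts G \<Longrightarrow> out_degree G x = (\<Sum>y\<in>verts G. count (arcs G) (x, y))"
  unfolding out_degree_def using arcs_verts
  by (intro size_filter_mset_eq_sum_count) (force simp: finite_verts inj_on_def)+

lemma in_degree_eq_sum:
  "x \<in> verts G \<Longrightarrow> in_degree G x = (\<Sum>y\<in>verts G. count (arcs G) (y, x))"
  unfolding in_degree_def using arcs_verts
  by (intro size_filter_mset_eq_sum_count) (force simp: finite_verts inj_on_def)+

text \<open>The map \<open>Upair x\<close> indexes the edges at \<open>x\<close> by their other
  endpoint. The sum meets the loops at \<open>x\<close> once, at \<open>y = x\<close>; the last
  summand is their second count.\<close>

lemma degree_eq_sum:
  assumes "x \<in> verts G"
  shows "degree G x = (\<Sum>y\<in>verts G. count (edges G) (Upair x y)) + count (edges G) (Upair x x)"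
proof -
  have "{e \<in> set_mset (edges G). x \<in> set_uprod e} \<subseteq> Upair x ` verts G"
  proof
    fix e assume e: "e \<in> {e \<in> set_mset (edges G). x \<in> set_uprod e}"
    obtain a b where ab: "e = Upair a b" by (cases e)
    show "e \<in> Upair x ` verts G"
      using e edges_verts[of e] unfolding ab by (auto simp: image_iff)
  qed
  then show ?thesis
    unfolding degree_def
    by (subst size_filter_mset_eq_sum_count[where A = "verts G" and g = "Upair x"])
       (auto simp: finite_verts inj_on_def)
qed

end

lemma sum_lessThan_double:
  fixes f :: "nat \<Rightarrow> 'b::comm_monoid_add"
  shows "(\<Sum>j<2 * n. f j) = (\<Sum>j<n. f j) + (\<Sum>j<n. f (n + j))"
proof -
  have "(\<Sum>j<2 * n. f j) = (\<Sum>j<n. f j) + (\<Sum>j=n..<n + n. f j)"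
    by (simp add: mult_2 lessThan_atLeast0 sum.atLeastLessThan_concat)
  also have "(\<Sum>j=n..<n + n. f j) = (\<Sum>j<n. f (n + j))"
    using sum.shift_bounds_nat_ivl[of f 0 n n] by (simp add: lessThan_atLeast0 add.commute)
  finally show ?thesis .
qed

locale enumerated_mixed_graph = mixed_graph G for G :: "'a mgraph" +
  fixes n :: nat and v :: "nat \<Rightarrow> 'a"
  assumes bij_v: "bij_betw v {..<n} (verts G)"
begin

lemma v_in_verts: "i < n \<Longrightarrow> v i \<in> verts G"
  using bij_v by (auto simp: bij_betw_def)

lemma sum_verts: "(\<Sum>y\<in>verts G. f y) = (\<Sum>j<n. f (v j))"
  using sum.reindex_bij_betw[OF bij_v, of f] by simp

text \<open>The factor 2 on the diagonal matches the double count of loops in \<open>degree\<close>,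
  so it is split off as one extra term at \<open>j = i\<close>.\<close>

lemma edge_matrix_row_sum:
  assumes "i < n"
  shows "(\<Sum>j<n. edge_matrix n v G $$ (i, j)) = real (degree G (v i))"
proof -
  have "(\<Sum>j<n. edge_matrix n v G $$ (i, j)) =
    (\<Sum>j<n. real (count (edges G) (Upair (v i) (v j)))
      + (if j = i then real (count (edges G) (Upair (v i) (v i))) else 0))"
    using assms by (intro sum.cong) (auto simp: edge_matrix_def)
  then show ?thesis
    using assms by (simp add: sum.distrib degree_eq_sum v_in_verts sum_verts)
qed

lemma arc_matrix_row_sum:
  "i < n \<Longrightarrow> (\<Sum>j<n. arc_matrix n v G $$ (i, j)) = real (out_degree G (v i))"
  by (simp add: arc_matrix_def out_degree_eq_sum v_in_verts sum_verts)

lemma arc_matrix_col_sum: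
  "i < n \<Longrightarrow> (\<Sum>j<n. arc_matrix n v G $$ (j, i)) = real (in_degree G (v i))"
  by (simp add: arc_matrix_def in_degree_eq_sum v_in_verts sum_verts)

lemma dim_integrated_signless_laplacian [simp]:
  "dim_row (integrated_signless_laplacian n v G) = 2 * n"
  "dim_col (integrated_signless_laplacian n v G) = 2 * n"
  by (simp_all add: integrated_signless_laplacian_def integrated_adjacency_def
      edge_matrix_def arc_matrix_def)

text \<open>The parameter \<open>c\<close> treats both candidate eigenvectors in one computation.
  One half of the term in d comes from the degree matrix, the other from the edge block.\<close>

lemma integrated_signless_laplacian_mult_block_constant:
  fixes c :: real
  shows "integrated_signless_laplacian n v G *\<^sub>v (all_ones_vec n @\<^sub>v c \<cdot>\<^sub>v all_ones_vec n) =
    vec n (\<lambda>i. 2 * real (degree G (v i)) + (1 + c) * real (out_degree G (v i))) @\<^sub>v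
    vec n (\<lambda>i. 2 * c * real (degree G (v i)) + (1 + c) * real (in_degree G (v i)))"
    (is "?Q *\<^sub>v ?x = ?y")
proof (rule eq_vecI)
  fix i assume "i < dim_vec ?y"
  then have i: "i < 2 * n" by simp
  \<comment> \<open>Isolating the diagonal part lets the degree matrix contribute a single term to
    the row sum.\<close>
  have Q: "?Q $$ (i, j) = (if i = j then integrated_degree n v G $$ (i, i) else 0)
      + integrated_adjacency n v G $$ (i, j)" if "j < 2 * n" for j
    using i that
    by (auto simp: integrated_signless_laplacian_def integrated_adjacency_def
        edge_matrix_def arc_matrix_def integrated_degree_def mat_diag_def)
  have x: "?x $ j = (if j < n then 1 else c)" if "j < 2 * n" for j
    using that by (auto simp: all_ones_vec_def)
  have "(?Q *\<^sub>v ?x) $ i = (\<Sum>j<2 * n. ?Q $$ (i, j) * ?x $ j)"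
    using i by (simp add: scalar_prod_def lessThan_atLeast0 all_ones_vec_def mult_2)
  also have "\<dots> = (\<Sum>j<2 * n. (if i = j then integrated_degree n v G $$ (i, i) * ?x $ i else 0)
      + integrated_adjacency n v G $$ (i, j) * ?x $ j)"
  proof (rule sum.cong)
    fix j assume "j \<in> {..<2 * n}"
    then have "j < 2 * n" by simp
    then show "?Q $$ (i, j) * ?x $ j =
      (if i = j then integrated_degree n v G $$ (i, i) * ?x $ i else 0)
        + integrated_adjacency n v G $$ (i, j) * ?x $ j"
      by (simp add: Q distrib_right del: index_append_vec)
  qed simp
  also have "\<dots> = integrated_degree n v G $$ (i, i) * ?x $ i
      + (\<Sum>j<2 * n. integrated_adjacency n v G $$ (i, j) * ?x $ j)"
    using i by (simp add: sum.distrib del: index_append_vec)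
  also have "(\<Sum>j<2 * n. integrated_adjacency n v G $$ (i, j) * ?x $ j) =
      (\<Sum>j<2 * n. integrated_adjacency n v G $$ (i, j) * (if j < n then 1 else c))"
    by (intro sum.cong) (simp_all add: x del: index_append_vec)
  also have "\<dots> = (\<Sum>j<n. integrated_adjacency n v G $$ (i, j))
      + c * (\<Sum>j<n. integrated_adjacency n v G $$ (i, n + j))"
    unfolding sum_lessThan_double by (simp add: sum_distrib_left mult.commute)
  also have "integrated_degree n v G $$ (i, i) * ?x $ i + \<dots> = ?y $ i"
  proof (cases "i < n")
    case True
    have "(\<Sum>j<n. integrated_adjacency n v G $$ (i, j)) = real (degree G (v i))"
      "(\<Sum>j<n. integrated_adjacency n v G $$ (i, n + j)) = real (out_degree G (v i))"
      using True
      by (simp_all add: integrated_adjacency_def flip: edge_matrix_row_sum arc_matrix_row_sum)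
         (simp_all add: edge_matrix_def arc_matrix_def)
    then show ?thesis
      using i True by (simp add: x integrated_degree_def mat_diag_def algebra_simps
          del: index_append_vec(1)) (simp add: all_ones_vec_def)
  next
    case False
    then obtain k where k: "i = n + k" "k < n"
      using i by (metis add_less_cancel_left le_Suc_ex mult_2 not_less)
    \<comment> \<open>The lower left block is the transposed arc matrix, so its row sums are column
      sums of \<open>arc_matrix\<close>, that is, in-degrees.\<close>
    have "(\<Sum>j<n. integrated_adjacency n v G $$ (i, j)) = real (in_degree G (v k))"
      "(\<Sum>j<n. integrated_adjacency n v G $$ (i, n + j)) = real (degree G (v k))"
      using k
      by (simp_all add: integrated_adjacency_def flip: edge_matrix_row_sum arc_matrix_col_sum)
         (simp_all add: edge_matrix_def arc_matrix_def)
    then show ?thesis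
      using i k by (simp add: x integrated_degree_def mat_diag_def algebra_simps
          del: index_append_vec(1)) (simp add: all_ones_vec_def)
  qed
  finally show "(?Q *\<^sub>v ?x) $ i = ?y $ i" .
qed simp

lemma eigenvector_block_constant_iff:
  fixes c k :: real
  assumes "n \<ge> 1"
  shows "eigenvector (integrated_signless_laplacian n v G)
      (all_ones_vec n @\<^sub>v c \<cdot>\<^sub>v all_ones_vec n) k \<longleftrightarrow>
    (\<forall>u\<in>verts G. 2 * real (degree G u) + (1 + c) * real (out_degree G u) = k \<and>
      2 * c * real (degree G u) + (1 + c) * real (in_degree G u) = k * c)"
    (is "eigenvector ?Q ?x k \<longleftrightarrow> _")
proof -
  \<comment> \<open>An eigenvector must be nonzero: since \<open>n \<ge> 1\<close>, coordinate 0
    lies in the first block, where the entry is 1 whatever \<open>c\<close> is.\<close>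
  have "?x $ 0 \<noteq> 0\<^sub>v (2 * n) $ 0"
    using assms by (simp add: all_ones_vec_def)
  then have "?x \<noteq> 0\<^sub>v (2 * n)" by (rule contrapos_nn) simp
  moreover have "?x \<in> carrier_vec (2 * n)"
    by (rule carrier_vecI) (simp add: all_ones_vec_def)
  moreover have "k \<cdot>\<^sub>v ?x = vec n (\<lambda>_. k) @\<^sub>v vec n (\<lambda>_. k * c)"
    by (intro eq_vecI) (auto simp: all_ones_vec_def)
  ultimately have "eigenvector ?Q ?x k \<longleftrightarrow>
    (\<forall>i<n. 2 * real (degree G (v i)) + (1 + c) * real (out_degree G (v i)) = k \<and>
      2 * c * real (degree G (v i)) + (1 + c) * real (in_degree G (v i)) = k * c)"
    unfolding eigenvector_def integrated_signless_laplacian_mult_block_constant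
    by (simp only: dim_integrated_signless_laplacian simp_thms
        append_vec_eq[OF vec_carrier vec_carrier])
       (auto simp: vec_eq_iff)
  also have "\<dots> \<longleftrightarrow>
    (\<forall>u\<in>v ` {..<n}. 2 * real (degree G u) + (1 + c) * real (out_degree G u) = k \<and>
      2 * c * real (degree G u) + (1 + c) * real (in_degree G u) = k * c)"
    by blast
  finally show ?thesis
    unfolding bij_betw_imp_surj_on[OF bij_v] .
qed

end

theorem theorem4p5:
  fixes G :: "'a mgraph" and v :: "nat \<Rightarrow> 'a" and n r s :: nat
  assumes "mixed_graph G"
    and "n \<ge> 1"
    and "bij_betw v {..<n} (verts G)"
  shows "mixed_regular r s G \<longleftrightarrow>
    eigenvector (integrated_signless_laplacian n v G) (all_ones_vec (2 * n)) (real (2 * (r + s))) \<and>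
    eigenvector (integrated_signless_laplacian n v G)
      (all_ones_vec n @\<^sub>v (- all_ones_vec n)) (real (2 * r))"
proof -
  interpret enumerated_mixed_graph G n v
    using assms by (simp add: enumerated_mixed_graph_def enumerated_mixed_graph_axioms_def)
  \<comment> \<open>Both vectors are brought into the block-constant form, with c = 1 and c =
    -1.\<close>
  have "all_ones_vec (2 * n) = all_ones_vec n @\<^sub>v 1 \<cdot>\<^sub>v all_ones_vec n"
    by (rule eq_vecI) (auto simp: all_ones_vec_def)
  moreover have "- all_ones_vec n = (- 1) \<cdot>\<^sub>v all_ones_vec n"
    by (rule eq_vecI) (auto simp: all_ones_vec_def)
  \<comment> \<open>The conditions for c = -1 both reduce to d = r; substituting this into those for
    c = 1 leaves d^+ = s and d^- = s.\<close>
  moreover have "(\<forall>u\<in>verts G. 2 * real (degree G u) + (1 + 1) * real (out_degree G u) = real (2 * (r + s)) \<and>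
        2 * 1 * real (degree G u) + (1 + 1) * real (in_degree G u) = real (2 * (r + s)) * 1) \<and>
      (\<forall>u\<in>verts G. 2 * real (degree G u) + (1 + - 1) * real (out_degree G u) = real (2 * r) \<and>
        2 * - 1 * real (degree G u) + (1 + - 1) * real (in_degree G u) = real (2 * r) * - 1)
    \<longleftrightarrow> mixed_regular r s G"
    by (auto simp: mixed_regular_def)
  ultimately show ?thesis
    by (simp only: eigenvector_block_constant_iff[OF assms(2)])
qed

end
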